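(* Let $\mathbb{A}$ be a finite Cauchy-complete category and let $k^\bullet$ be a weighting on $\mathbb{A}$. If $X: \mathbb{A} \to \mathbf{Set}$ is a finite and nondegenerate functor, then the cardinality of the colimit of $X$ is $$\Bigl|\varinjlim X\Bigr| = \sum_{a \in \mathbb{A}} k^a\, |Xa|.$$
   Context: A category is Cauchy-complete if every idempotent $e: a \to a$ in it splits, i.e. there are maps $s: a \to b$ and $i: b \to a$ with $si = 1_b$ and $is = e$. For a finite category $\mathbb{A}$ (finitely many objects and arrows), a weighting on $\mathbb{A}$ is a function $k^\bullet: \mathrm{ob}\,\mathbb{A} \to \mathbb{Q}$ such that $\sum_{b \in \mathbb{A}} |\mathbb{A}(a,b)|\, k^b = 1$ for all $a \in \mathbb{A}$. A functor $X: \mathbb{A} \to \mathbf{Set}$ is finite if its category of elements is finite; since $\mathbb{A}$ is finite, this means that each set $Xa$ is finite. A functor $X: \mathbb{A} \to \mathbf{Set}$ is nondegenerate if both of the following hold: (i) given arrows $f: a \to b$ and $f': a' \to b$ in $\mathbb{A}$ and $x \in Xa$, $x' \in Xa'$ with $(Xf)(x) = (Xf')(x')$, there exist an object $c$, arrows $g: c \to a$, $g': c \to a'$ and $z \in Xc$ with $fg = f'g'$, $(Xg)(z) = x$ and $(Xg')(z) = x'$; (ii) given arrows $f, f': a \to b$ in $\mathbb{A}$ and $x \in Xa$ with $(Xf)(x) = (Xf')(x)$, there exist an arrow $g: c \to a$ and $z \in Xc$ with $fg = f'g$ and $(Xg)(z) = x$. *)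

theory Defs
  imports Complex_Main "HOL-Library.FuncSet"
begin

section \<open>Categories\<close>

text \<open>Small categories given by sets of objects and arrows. \<open>Comp C g f\<close> is the composite
  \<open>gf\<close> (first \<open>f\<close>, then \<open>g\<close>); it is only meaningful when \<open>Cod C f = Dom C g\<close>.\<close>

record ('o, 'm) cat =
  Ob :: "'o set"
  Ar :: "'m set"
  Dom :: "'m \<Rightarrow> 'o"
  Cod :: "'m \<Rightarrow> 'o"
  Id :: "'o \<Rightarrow> 'm"
  Comp :: "'m \<Rightarrow> 'm \<Rightarrow> 'm"

definition hom :: "('o, 'm) cat \<Rightarrow> 'o \<Rightarrow> 'o \<Rightarrow> 'm set" where
  "hom C a b = {f \<in> Ar C. Dom C f = a \<and> Cod C f = b}"

locale category =
  fixes C :: "('o, 'm) cat"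
  assumes dom_in: "f \<in> Ar C \<Longrightarrow> Dom C f \<in> Ob C"
    and cod_in: "f \<in> Ar C \<Longrightarrow> Cod C f \<in> Ob C"
    and id_in: "a \<in> Ob C \<Longrightarrow> Id C a \<in> hom C a a"
    and comp_in: "f \<in> hom C a b \<Longrightarrow> g \<in> hom C b c \<Longrightarrow> Comp C g f \<in> hom C a c"
    and id_left: "f \<in> hom C a b \<Longrightarrow> Comp C (Id C b) f = f"
    and id_right: "f \<in> hom C a b \<Longrightarrow> Comp C f (Id C a) = f"
    and comp_assoc: "f \<in> hom C a b \<Longrightarrow> g \<in> hom C b c \<Longrightarrow> h \<in> hom C c d
      \<Longrightarrow> Comp C h (Comp C g f) = Comp C (Comp C h g) f"

locale finite_category = category +
  assumes finite_Ob: "finite (Ob C)"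
    and finite_Ar: "finite (Ar C)"

definition cauchy_complete :: "('o, 'm) cat \<Rightarrow> bool" where
  "cauchy_complete C \<longleftrightarrow> (\<forall>a \<in> Ob C. \<forall>e \<in> hom C a a. Comp C e e = e \<longrightarrow>
     (\<exists>b \<in> Ob C. \<exists>s \<in> hom C a b. \<exists>i \<in> hom C b a.
        Comp C s i = Id C b \<and> Comp C i s = e))"

definition weighting :: "('o, 'm) cat \<Rightarrow> ('o \<Rightarrow> rat) \<Rightarrow> bool" where
  "weighting C k \<longleftrightarrow> (\<forall>a \<in> Ob C. (\<Sum>b \<in> Ob C. of_nat (card (hom C a b)) * k b) = 1)"


section \<open>Set-valued functors\<close>

text \<open>All the sets \<open>Xa\<close> are subsets of one type \<open>'x\<close>; they need not be disjoint.
  \<open>FAr X f\<close> is only meaningful on \<open>FOb X (Dom C f)\<close>.\<close>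

record ('o, 'm, 'x) set_fun =
  FOb :: "'o \<Rightarrow> 'x set"
  FAr :: "'m \<Rightarrow> 'x \<Rightarrow> 'x"

locale set_functor = category C for C :: "('o, 'm) cat" +
  fixes X :: "('o, 'm, 'x) set_fun"
  assumes FAr_in: "f \<in> hom C a b \<Longrightarrow> FAr X f \<in> FOb X a \<rightarrow> FOb X b"
    and FAr_id: "a \<in> Ob C \<Longrightarrow> x \<in> FOb X a \<Longrightarrow> FAr X (Id C a) x = x"
    and FAr_comp: "f \<in> hom C a b \<Longrightarrow> g \<in> hom C b c \<Longrightarrow> x \<in> FOb X a
      \<Longrightarrow> FAr X (Comp C g f) x = FAr X g (FAr X f x)"

text \<open>An arrow \<open>(a, x) \<rightarrow> (b, y)\<close> of the category of elements is an arrow \<open>f : a \<rightarrow> b\<close> with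
  \<open>(Xf)(x) = y\<close>; it is encoded as the pair \<open>(f, x)\<close>, which determines both endpoints.\<close>

definition elements_cat ::
    "('o, 'm) cat \<Rightarrow> ('o, 'm, 'x) set_fun \<Rightarrow> ('o \<times> 'x, 'm \<times> 'x) cat" where
  "elements_cat C X = \<lparr>
     Ob = (SIGMA a : Ob C. FOb X a),
     Ar = (SIGMA f : Ar C. FOb X (Dom C f)),
     Dom = (\<lambda>(f, x). (Dom C f, x)),
     Cod = (\<lambda>(f, x). (Cod C f, FAr X f x)),
     Id = (\<lambda>(a, x). (Id C a, x)),
     Comp = (\<lambda>(g, y) (f, x). (Comp C g f, x))\<rparr>"

definition finite_set_functor :: "('o, 'm) cat \<Rightarrow> ('o, 'm, 'x) set_fun \<Rightarrow> bool" where
  "finite_set_functor C X \<longleftrightarrow> finite_category (elements_cat C X)"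

definition nondegenerate :: "('o, 'm) cat \<Rightarrow> ('o, 'm, 'x) set_fun \<Rightarrow> bool" where
  "nondegenerate C X \<longleftrightarrow>
     (\<forall>a \<in> Ob C. \<forall>a' \<in> Ob C. \<forall>b \<in> Ob C. \<forall>f \<in> hom C a b. \<forall>f' \<in> hom C a' b.
        \<forall>x \<in> FOb X a. \<forall>x' \<in> FOb X a'. FAr X f x = FAr X f' x' \<longrightarrow>
          (\<exists>c \<in> Ob C. \<exists>g \<in> hom C c a. \<exists>g' \<in> hom C c a'. \<exists>z \<in> FOb X c.
             Comp C f g = Comp C f' g' \<and> FAr X g z = x \<and> FAr X g' z = x')) \<and>
     (\<forall>a \<in> Ob C. \<forall>b \<in> Ob C. \<forall>f \<in> hom C a b. \<forall>f' \<in> hom C a b.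
        \<forall>x \<in> FOb X a. FAr X f x = FAr X f' x \<longrightarrow>
          (\<exists>c \<in> Ob C. \<exists>g \<in> hom C c a. \<exists>z \<in> FOb X c.
             Comp C f g = Comp C f' g \<and> FAr X g z = x))"


section \<open>Colimits of set-valued functors\<close>

text \<open>The standard construction of the colimit in sets: the disjoint union of the \<open>Xa\<close> modulo
  the equivalence relation generated by \<open>(a, x) \<sim> (b, (Xf)(x))\<close> for \<open>f : a \<rightarrow> b\<close>. The universal
  property, against targets of an arbitrary type, is proved below.\<close>

definition colim_rel ::
    "('o, 'm) cat \<Rightarrow> ('o, 'm, 'x) set_fun \<Rightarrow> (('o \<times> 'x) \<times> ('o \<times> 'x)) set" where
  "colim_rel C X =
     {((a, x), (b, FAr X f x)) | a b f x. f \<in> hom C a b \<and> x \<in> FOb X a}"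

definition colim_eq ::
    "('o, 'm) cat \<Rightarrow> ('o, 'm, 'x) set_fun \<Rightarrow> (('o \<times> 'x) \<times> ('o \<times> 'x)) set" where
  "colim_eq C X = (colim_rel C X \<union> (colim_rel C X)\<inverse>)\<^sup>*"

definition colim :: "('o, 'm) cat \<Rightarrow> ('o, 'm, 'x) set_fun \<Rightarrow> ('o \<times> 'x) set set" where
  "colim C X = (SIGMA a : Ob C. FOb X a) // colim_eq C X"

definition colim_inj ::
    "('o, 'm) cat \<Rightarrow> ('o, 'm, 'x) set_fun \<Rightarrow> 'o \<Rightarrow> 'x \<Rightarrow> ('o \<times> 'x) set" where
  "colim_inj C X a x = colim_eq C X `` {(a, x)}"

definition cocone ::
    "('o, 'm) cat \<Rightarrow> ('o, 'm, 'x) set_fun \<Rightarrow> 'y set \<Rightarrow> ('o \<Rightarrow> 'x \<Rightarrow> 'y) \<Rightarrow> bool" where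
  "cocone C X Y p \<longleftrightarrow>
     (\<forall>a \<in> Ob C. p a \<in> FOb X a \<rightarrow> Y) \<and>
     (\<forall>a \<in> Ob C. \<forall>b \<in> Ob C. \<forall>f \<in> hom C a b. \<forall>x \<in> FOb X a. p b (FAr X f x) = p a x)"


section \<open>Sanity checks\<close>

lemma (in set_functor) category_elements: "category (elements_cat C X)"
proof unfold_locales
  fix f assume "f \<in> Ar (elements_cat C X)"
  then show "Dom (elements_cat C X) f \<in> Ob (elements_cat C X)"
    by (auto simp: elements_cat_def dom_in)
next
  fix f assume "f \<in> Ar (elements_cat C X)"
  then show "Cod (elements_cat C X) f \<in> Ob (elements_cat C X)"
    using FAr_in by (auto simp: elements_cat_def cod_in hom_def)
next
  fix a assume "a \<in> Ob (elements_cat C X)"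
  then show "Id (elements_cat C X) a \<in> hom (elements_cat C X) a a"
    using id_in FAr_id by (auto simp: elements_cat_def hom_def)
next
  fix f a b g c
  assume "f \<in> hom (elements_cat C X) a b" "g \<in> hom (elements_cat C X) b c"
  then show "Comp (elements_cat C X) g f \<in> hom (elements_cat C X) a c"
    using comp_in FAr_comp by (fastforce simp: elements_cat_def hom_def)
next
  fix f a b assume "f \<in> hom (elements_cat C X) a b"
  then show "Comp (elements_cat C X) (Id (elements_cat C X) b) f = f"
    using id_left by (auto simp: elements_cat_def hom_def)
next
  fix f a b assume "f \<in> hom (elements_cat C X) a b"
  then show "Comp (elements_cat C X) f (Id (elements_cat C X) a) = f"
    using id_right by (auto simp: elements_cat_def hom_def)
next
  fix f a b g c h d
  assume "f \<in> hom (elements_cat C X) a b" "g \<in> hom (elements_cat C X) b c"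
    "h \<in> hom (elements_cat C X) c d"
  then show "Comp (elements_cat C X) h (Comp (elements_cat C X) g f)
      = Comp (elements_cat C X) (Comp (elements_cat C X) h g) f"
    using comp_assoc[of "fst f" "fst a" "fst b" "fst g" "fst c" "fst h" "fst d"]
    by (auto simp: elements_cat_def hom_def)
qed

lemma finite_set_functor_iff:
  assumes "finite_category C" and "set_functor C X"
  shows "finite_set_functor C X \<longleftrightarrow> (\<forall>a \<in> Ob C. finite (FOb X a))"
proof
  assume "finite_set_functor C X"
  then have fin: "finite (SIGMA a : Ob C. FOb X a)"
    by (auto simp: finite_set_functor_def elements_cat_def finite_category_def
        finite_category_axioms_def)
  show "\<forall>a \<in> Ob C. finite (FOb X a)"
  proof
    fix a assume "a \<in> Ob C"
    then have "Pair a ` FOb X a \<subseteq> (SIGMA a : Ob C. FOb X a)" by auto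
    then have "finite (Pair a ` FOb X a)" using fin finite_subset by blast
    then show "finite (FOb X a)" by (rule finite_imageD) (simp add: inj_on_def)
  qed
next
  interpret finite_category C by fact
  assume "\<forall>a \<in> Ob C. finite (FOb X a)"
  then show "finite_set_functor C X"
    using set_functor.category_elements[OF assms(2)] finite_Ob finite_Ar dom_in
    by (auto simp: finite_set_functor_def elements_cat_def finite_category_def
        finite_category_axioms_def)
qed

lemma finite_colim:
  assumes "finite_set_functor C X"
  shows "finite (colim C X)"
proof -
  have "finite (SIGMA a : Ob C. FOb X a)"
    using assms by (auto simp: finite_set_functor_def elements_cat_def finite_category_def
        finite_category_axioms_def)
  moreover have "colim C X = (\<lambda>e. colim_eq C X `` {e}) ` (SIGMA a : Ob C. FOb X a)"
    by (auto simp: colim_def quotient_def)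
  ultimately show ?thesis by simp
qed

lemma equiv_colim_eq: "equiv UNIV (colim_eq C X)"
proof (rule equivI)
  show "sym (colim_eq C X)"
    unfolding colim_eq_def by (rule sym_rtrancl) (auto simp: sym_def)
qed (auto simp: colim_eq_def refl_rtrancl trans_rtrancl)

lemma (in set_functor) cocone_colim: "cocone C X (colim C X) (colim_inj C X)"
  unfolding cocone_def
proof (intro conjI ballI)
  fix a assume "a \<in> Ob C"
  then show "colim_inj C X a \<in> FOb X a \<rightarrow> colim C X"
    by (auto simp: colim_inj_def colim_def intro!: quotientI)
next
  fix a b f x assume "f \<in> hom C a b" "x \<in> FOb X a"
  then have "((a, x), (b, FAr X f x)) \<in> colim_eq C X"
    unfolding colim_eq_def colim_rel_def by blast
  then show "colim_inj C X b (FAr X f x) = colim_inj C X a x"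
    unfolding colim_inj_def using equiv_class_eq[OF equiv_colim_eq] by metis
qed

lemma (in set_functor) colim_universal:
  assumes "cocone C X Y p"
  shows "\<exists>!h. h \<in> colim C X \<rightarrow>\<^sub>E Y \<and>
    (\<forall>a \<in> Ob C. \<forall>x \<in> FOb X a. h (colim_inj C X a x) = p a x)"
proof -
  have inv: "p (fst e) (snd e) = p (fst e') (snd e')" if "(e, e') \<in> colim_eq C X" for e e'
    using that unfolding colim_eq_def
  proof (induction rule: rtrancl_induct)
    case (step y z)
    then show ?case
      using assms dom_in cod_in by (force simp: cocone_def colim_rel_def hom_def)
  qed simp
  define h where "h = (\<lambda>q \<in> colim C X. let e = (SOME e. e \<in> q) in p (fst e) (snd e))"
  have h: "h (colim_inj C X a x) = p a x" if "a \<in> Ob C" "x \<in> FOb X a" for a x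
  proof -
    have "(a, x) \<in> colim_inj C X a x" by (simp add: colim_inj_def colim_eq_def)
    then have "(SOME e. e \<in> colim_inj C X a x) \<in> colim_inj C X a x" by (rule someI)
    then have "((a, x), (SOME e. e \<in> colim_inj C X a x)) \<in> colim_eq C X"
      by (simp add: colim_inj_def)
    from inv[OF this] have "p (fst (SOME e. e \<in> colim_inj C X a x))
        (snd (SOME e. e \<in> colim_inj C X a x)) = p a x" by simp
    moreover have "colim_inj C X a x \<in> colim C X"
      using that cocone_colim by (auto simp: cocone_def)
    ultimately show ?thesis by (simp add: h_def Let_def)
  qed
  have surj: "\<exists>a \<in> Ob C. \<exists>x \<in> FOb X a. q = colim_inj C X a x" if "q \<in> colim C X" for q
    using that by (auto simp: colim_def colim_inj_def quotient_def)
  have hE: "h \<in> colim C X \<rightarrow>\<^sub>E Y"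
  proof (rule PiE_I)
    fix q assume "q \<in> colim C X"
    then obtain a x where "a \<in> Ob C" "x \<in> FOb X a" "q = colim_inj C X a x" using surj by blast
    then show "h q \<in> Y" using h assms by (auto simp: cocone_def)
  qed (simp add: h_def)
  have "h' = h"
    if h': "h' \<in> colim C X \<rightarrow>\<^sub>E Y" "\<forall>a \<in> Ob C. \<forall>x \<in> FOb X a. h' (colim_inj C X a x) = p a x" for h'
  proof (rule PiE_ext[OF h'(1) hE])
    fix q assume "q \<in> colim C X"
    then obtain a x where q: "a \<in> Ob C" "x \<in> FOb X a" "q = colim_inj C X a x" using surj by blast
    then show "h' q = h q" using h h'(2) by simp
  qed
  then show ?thesis
    by (intro ex1I[of _ h]) (use h hE in blast)+
qed

end

theory Submission
  imports Defs
begin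

text \<open>
  A finite nondegenerate functor \<open>X\<close> on a finite Cauchy-complete category is a disjoint union of
  representables, one for each element of the colimit. Granting this, say \<open>X \<cong> \<Sum>\<^sub>q A(a\<^sub>q, -)\<close>, the
  theorem is a double count:
  \<open>\<Sum>\<^sub>b k\<^sup>b |X b| = \<Sum>\<^sub>q \<Sum>\<^sub>b |A(a\<^sub>q, b)| k\<^sup>b = \<Sum>\<^sub>q 1\<close>, by the weighting equation at each \<open>a\<^sub>q\<close>.

  The elements of the colimit are the connected components of the category of elements, and a
  decomposition into representables amounts to an initial object in each component
  (\<open>initial_element_exists\<close>). Nondegeneracy says that the components are cofiltered: squares
  can be completed below a cospan and parallel arrows can be equalized. In a finite component this
  gives an object \<open>m\<close> with an arrow to every object, and then an endomorphism \<open>e\<close> of \<open>m\<close>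
  that equalizes all parallel pairs out of \<open>m\<close> at once. Applied to the pair \<open>e\<close>, \<open>1\<close> this says
  that \<open>e\<close> is idempotent. Its splitting, which exists in the base by Cauchy-completeness and
  lifts to the elements, is initial: it still maps to everything, and parallel arrows out of it
  are equal because they become parallel arrows out of \<open>m\<close>, hence equal after \<open>e\<close>, on composition
  with the split epimorphism from \<open>m\<close>.
\<close>

section \<open>Arrows and components of the category of elements\<close>

text \<open>A hom-set of the category of elements, with the element that \<open>elements_cat\<close> attaches to each
  arrow dropped: both endpoints are given here, and so composition is plain composition in \<open>C\<close>.\<close>

definition elements_hom ::
    "('o, 'm) cat \<Rightarrow> ('o, 'm, 'x) set_fun \<Rightarrow> 'o \<times> 'x \<Rightarrow> 'o \<times> 'x \<Rightarrow> 'm set" where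
  "elements_hom C X p q =
     {f \<in> hom C (fst p) (fst q). snd p \<in> FOb X (fst p) \<and> FAr X f (snd p) = snd q}"

definition initial_element ::
    "('o, 'm) cat \<Rightarrow> ('o, 'm, 'x) set_fun \<Rightarrow> ('o \<times> 'x) set \<Rightarrow> 'o \<times> 'x \<Rightarrow> bool" where
  "initial_element C X Q p \<longleftrightarrow> p \<in> Q \<and> (\<forall>r \<in> Q. \<exists>!f. f \<in> elements_hom C X p r)"

context set_functor
begin

lemma elements_hom_id:
  "p \<in> (SIGMA a : Ob C. FOb X a) \<Longrightarrow> Id C (fst p) \<in> elements_hom C X p p"
  using id_in FAr_id by (auto simp: elements_hom_def)

lemma elements_hom_comp:
  "f \<in> elements_hom C X p q \<Longrightarrow> g \<in> elements_hom C X q r \<Longrightarrow> Comp C g f \<in> elements_hom C X p r"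
  using comp_in FAr_comp by (auto simp: elements_hom_def)

lemma elements_hom_hom: "f \<in> elements_hom C X p q \<Longrightarrow> f \<in> hom C (fst p) (fst q)"
  by (simp add: elements_hom_def)

lemma elements_hom_assoc:
  assumes "f \<in> elements_hom C X p q" "g \<in> elements_hom C X q r" "h \<in> elements_hom C X r t"
  shows "Comp C h (Comp C g f) = Comp C (Comp C h g) f"
  by (rule comp_assoc[OF assms[THEN elements_hom_hom]])

lemma elements_hom_in:
  assumes "f \<in> elements_hom C X p q"
  shows "p \<in> (SIGMA a : Ob C. FOb X a)" and "q \<in> (SIGMA a : Ob C. FOb X a)"
proof -
  have f: "f \<in> hom C (fst p) (fst q)" "snd p \<in> FOb X (fst p)" "FAr X f (snd p) = snd q"
    using assms by (auto simp: elements_hom_def)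
  have "fst p \<in> Ob C" "fst q \<in> Ob C"
    using f(1) dom_in[of f] cod_in[of f] by (simp_all add: hom_def)
  moreover have "snd q \<in> FOb X (fst q)"
    using funcset_mem[OF FAr_in[OF f(1)] f(2)] f(3) by simp
  ultimately show "p \<in> (SIGMA a : Ob C. FOb X a)" "q \<in> (SIGMA a : Ob C. FOb X a)"
    using f(2) by (cases p; cases q; simp)+
qed

lemma colim_rel_iff: "(p, q) \<in> colim_rel C X \<longleftrightarrow> (\<exists>f. f \<in> elements_hom C X p q)"
  by (cases p; cases q) (auto simp: colim_rel_def elements_hom_def)

lemma colim_eq_elements_hom: "f \<in> elements_hom C X p q \<Longrightarrow> (p, q) \<in> colim_eq C X"
  unfolding colim_eq_def using colim_rel_iff by blast

lemma colim_subset: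
  assumes "Q \<in> colim C X"
  shows "Q \<subseteq> (SIGMA a : Ob C. FOb X a)"
proof -
  have "q \<in> (SIGMA a : Ob C. FOb X a)"
    if "(p, q) \<in> colim_eq C X" "p \<in> (SIGMA a : Ob C. FOb X a)" for p q
    using that unfolding colim_eq_def
  proof (induction rule: rtrancl_induct)
    case (step y z)
    then show ?case using elements_hom_in colim_rel_iff by blast
  qed
  then show ?thesis
    using assms by (auto simp: colim_def quotient_def)
qed

lemma colim_ex:
  assumes "p \<in> (SIGMA a : Ob C. FOb X a)"
  shows "\<exists>Q \<in> colim C X. p \<in> Q"
proof
  show "colim_eq C X `` {p} \<in> colim C X" unfolding colim_def by (rule quotientI[OF assms])
  show "p \<in> colim_eq C X `` {p}" by (rule equiv_class_self[OF equiv_colim_eq]) simp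
qed

lemma colim_eq_class:
  assumes "Q \<in> colim C X" "p \<in> Q"
  shows "Q = colim_eq C X `` {p}"
proof -
  obtain r where "Q = colim_eq C X `` {r}"
    using assms(1) unfolding colim_def by (rule quotientE)
  then show ?thesis using assms(2) equiv_class_eq[OF equiv_colim_eq, of r p] by auto
qed

lemma colim_disjoint:
  assumes "Q \<in> colim C X" "Q' \<in> colim C X" "p \<in> Q" "p \<in> Q'"
  shows "Q = Q'"
  using colim_eq_class[OF assms(1,3)] colim_eq_class[OF assms(2,4)] by simp

lemma colim_related:
  assumes "Q \<in> colim C X" "p \<in> Q" "q \<in> Q"
  shows "(p, q) \<in> colim_eq C X"
  using colim_eq_class[OF assms(1,2)] assms(3) by auto

lemma colim_closed:
  assumes "Q \<in> colim C X" "p \<in> Q" "(p, q) \<in> colim_eq C X"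
  shows "q \<in> Q"
  using colim_eq_class[OF assms(1,2)] assms(3) by auto

lemma colim_nonempty:
  assumes "Q \<in> colim C X"
  shows "\<exists>p. p \<in> Q"
proof -
  obtain r where "Q = colim_eq C X `` {r}"
    using assms unfolding colim_def by (rule quotientE)
  then show ?thesis using equiv_class_self[OF equiv_colim_eq UNIV_I, of r] by blast
qed

lemma colim_eq_sym: "(p, q) \<in> colim_eq C X \<Longrightarrow> (q, p) \<in> colim_eq C X"
  using equiv_colim_eq by (meson equivE symD)

end

section \<open>Components are cofiltered\<close>

locale nondegenerate_functor = set_functor +
  assumes nondegenerate: "nondegenerate C X"
begin

lemma cospan_completion:
  assumes "f \<in> elements_hom C X p r" "f' \<in> elements_hom C X p' r"
  shows "\<exists>s g g'. g \<in> elements_hom C X s p \<and> g' \<in> elements_hom C X s p'"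
proof -
  obtain a x a' x' b y where e: "p = (a, x)" "p' = (a', x')" "r = (b, y)"
    by (metis prod.exhaust)
  have "a \<in> Ob C" "a' \<in> Ob C" "b \<in> Ob C" "x \<in> FOb X a" "x' \<in> FOb X a'"
    "f \<in> hom C a b" "f' \<in> hom C a' b" "FAr X f x = FAr X f' x'"
    using assms elements_hom_in[OF assms(1)] elements_hom_in[OF assms(2)] e
    by (auto simp: elements_hom_def)
  then obtain c g g' z where "g \<in> hom C c a" "g' \<in> hom C c a'" "z \<in> FOb X c"
      "FAr X g z = x" "FAr X g' z = x'"
    using nondegenerate unfolding nondegenerate_def by meson
  then have "g \<in> elements_hom C X (c, z) p \<and> g' \<in> elements_hom C X (c, z) p'"
    by (auto simp: elements_hom_def e)
  then show ?thesis by blast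
qed

lemma parallel_equalized:
  assumes "f \<in> elements_hom C X p r" "f' \<in> elements_hom C X p r"
  shows "\<exists>s g. g \<in> elements_hom C X s p \<and> Comp C f g = Comp C f' g"
proof -
  obtain a x b y where e: "p = (a, x)" "r = (b, y)"
    by (metis prod.exhaust)
  have "a \<in> Ob C" "b \<in> Ob C" "x \<in> FOb X a"
    "f \<in> hom C a b" "f' \<in> hom C a b" "FAr X f x = FAr X f' x"
    using assms elements_hom_in[OF assms(1)] e by (auto simp: elements_hom_def)
  then obtain c g z where "g \<in> hom C c a" "z \<in> FOb X c" "FAr X g z = x" "Comp C f g = Comp C f' g"
    using nondegenerate unfolding nondegenerate_def by meson
  then have "g \<in> elements_hom C X (c, z) p \<and> Comp C f g = Comp C f' g"
    by (auto simp: elements_hom_def e)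
  then show ?thesis by blast
qed

text \<open>Having a common lower bound is already an equivalence relation, since completing cospans
  makes it transitive; hence it exhausts the equivalence relation generated by the arrows.\<close>

lemma colim_eq_lower_bound:
  assumes "(p, q) \<in> colim_eq C X" "p \<in> (SIGMA a : Ob C. FOb X a)"
  shows "\<exists>r f g. f \<in> elements_hom C X r p \<and> g \<in> elements_hom C X r q"
  using assms unfolding colim_eq_def
proof (induction rule: rtrancl_induct)
  case base
  then show ?case using elements_hom_id by blast
next
  case (step q q')
  then obtain r f g where r: "f \<in> elements_hom C X r p" "g \<in> elements_hom C X r q" by blast
  from step.hyps(2) consider h where "h \<in> elements_hom C X q q'" | h where "h \<in> elements_hom C X q' q"
    using colim_rel_iff by blast
  then show ?case
  proof cases
    case 1
    then show ?thesis using r elements_hom_comp by blast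
  next
    case 2
    then show ?thesis using r cospan_completion[OF r(2) 2] elements_hom_comp by blast
  qed
qed

text \<open>Taking \<open>F\<close> to be a whole finite component gives an object \<open>m\<close> with an arrow to
  every object of that component.\<close>

lemma finite_lower_bound:
  assumes "Q \<in> colim C X" "finite F" "F \<subseteq> Q"
  shows "\<exists>m \<in> Q. \<forall>p \<in> F. \<exists>f. f \<in> elements_hom C X m p"
  using assms(2,3)
proof (induction rule: finite_induct)
  case empty
  then show ?case
    using colim_nonempty[OF assms(1)] by blast
next
  case (insert p F)
  then obtain m where m: "m \<in> Q" "\<forall>p \<in> F. \<exists>f. f \<in> elements_hom C X m p" by blast
  have "(m, p) \<in> colim_eq C X" using colim_related[OF assms(1) m(1)] insert.prems by blast
  moreover have "m \<in> (SIGMA a : Ob C. FOb X a)" using colim_subset[OF assms(1)] m(1) by blast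
  ultimately obtain r f g where r: "f \<in> elements_hom C X r m" "g \<in> elements_hom C X r p"
    using colim_eq_lower_bound by blast
  have "(m, r) \<in> colim_eq C X"
    by (rule colim_eq_sym[OF colim_eq_elements_hom[OF r(1)]])
  then have "r \<in> Q" by (rule colim_closed[OF assms(1) m(1)])
  then show ?case using r m(2) elements_hom_comp by blast
qed

text \<open>Equalizing one pair more, by an arrow further down, does not spoil the pairs already
  equalized.\<close>

lemma finite_parallel_equalized:
  assumes "finite P" "m \<in> (SIGMA a : Ob C. FOb X a)"
    and "\<forall>(u, v) \<in> P. \<exists>r. u \<in> elements_hom C X m r \<and> v \<in> elements_hom C X m r"
  shows "\<exists>s g. g \<in> elements_hom C X s m \<and> (\<forall>(u, v) \<in> P. Comp C u g = Comp C v g)"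
  using assms(1,3)
proof (induction rule: finite_induct)
  case empty
  then show ?case using elements_hom_id[OF assms(2)] by blast
next
  case (insert uv P)
  then obtain s g where g: "g \<in> elements_hom C X s m" "\<forall>(u, v) \<in> P. Comp C u g = Comp C v g"
    by auto
  obtain u v r where uv: "uv = (u, v)" "u \<in> elements_hom C X m r" "v \<in> elements_hom C X m r"
    using insert.prems by (cases uv) auto
  obtain t h where h: "h \<in> elements_hom C X t s" "Comp C (Comp C u g) h = Comp C (Comp C v g) h"
    using parallel_equalized[OF elements_hom_comp[OF g(1) uv(2)] elements_hom_comp[OF g(1) uv(3)]]
    by blast
  have assoc: "Comp C w (Comp C g h) = Comp C (Comp C w g) h" if "w \<in> elements_hom C X m r'" for w r'
    by (rule elements_hom_assoc[OF h(1) g(1) that])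
  have "Comp C u' (Comp C g h) = Comp C v' (Comp C g h)" if uv': "(u', v') \<in> insert uv P" for u' v'
  proof (cases "(u', v') = uv")
    case True
    then show ?thesis using uv h(2) assoc by auto
  next
    case False
    then have "(u', v') \<in> P" using uv' by simp
    then have "Comp C u' g = Comp C v' g" using g(2) by auto
    moreover obtain r' where "u' \<in> elements_hom C X m r'" "v' \<in> elements_hom C X m r'"
      using bspec[OF insert.prems uv'] by auto
    ultimately show ?thesis by (simp add: assoc)
  qed
  then have "\<forall>(u', v') \<in> insert uv P. Comp C u' (Comp C g h) = Comp C v' (Comp C g h)"
    by auto
  then show ?case using elements_hom_comp[OF h(1) g(1)] by blast
qed

end

section \<open>Initial objects of components\<close>

text \<open>A least object \<open>m = (a, x)\<close> of the component need not be initial, but any two arrows from it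
  to the same object agree after a suitable endomorphism \<open>e\<close>, which is then idempotent. A
  splitting \<open>e = i s\<close> in \<open>C\<close> lifts to the category of elements, because \<open>i\<close> sends \<open>s x\<close> to
  \<open>e x = x\<close>; the middle object of the lifted splitting is initial.\<close>

lemma initial_element_exists:
  assumes "finite_category C" "cauchy_complete C" "set_functor C X" "finite_set_functor C X"
    "nondegenerate C X" and Q: "Q \<in> colim C X"
  shows "\<exists>p. initial_element C X Q p"
proof -
  interpret finite_category C by fact
  interpret nondegenerate_functor C X
    using assms by (simp add: nondegenerate_functor_def nondegenerate_functor_axioms_def)
  have "finite (SIGMA a : Ob C. FOb X a)"
    using assms finite_set_functor_iff[of C X] finite_Ob by auto
  then have "finite Q" using colim_subset[OF Q] finite_subset by blast
  then obtain m where m: "m \<in> Q" "\<And>p. p \<in> Q \<Longrightarrow> \<exists>f. f \<in> elements_hom C X m p"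
    using finite_lower_bound[OF Q, of Q] by blast
  then have mE: "m \<in> (SIGMA a : Ob C. FOb X a)" using colim_subset[OF Q] by blast
  define P where "P = {(u, v). \<exists>r. u \<in> elements_hom C X m r \<and> v \<in> elements_hom C X m r}"
  have "P \<subseteq> Ar C \<times> Ar C" by (auto simp: P_def elements_hom_def hom_def)
  then have "finite P" using finite_Ar finite_subset by blast
  then obtain l g where g: "g \<in> elements_hom C X l m" "\<forall>(u, v) \<in> P. Comp C u g = Comp C v g"
    using finite_parallel_equalized[OF _ mE, of P] by (auto simp: P_def)
  \<comment> \<open>The equalizing arrow \<open>g\<close> may start elsewhere; an arrow \<open>h\<close> from the least object \<open>m\<close>
    to its source turns it into an endomorphism of \<open>m\<close>.\<close>
  have "(m, l) \<in> colim_eq C X"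
    by (rule colim_eq_sym[OF colim_eq_elements_hom[OF g(1)]])
  then have "l \<in> Q" by (rule colim_closed[OF Q m(1)])
  then obtain h where h: "h \<in> elements_hom C X m l" using m(2) by blast
  define e where "e = Comp C g h"
  have e: "e \<in> elements_hom C X m m" unfolding e_def by (rule elements_hom_comp[OF h g(1)])
  have e_equalizes: "Comp C u e = Comp C v e"
    if "u \<in> elements_hom C X m r" "v \<in> elements_hom C X m r" for u v r
  proof -
    have "(u, v) \<in> P" unfolding P_def using that by blast
    then have "Comp C u g = Comp C v g" using g(2) by blast
    then show ?thesis
      unfolding e_def using elements_hom_assoc[OF h g(1)] that by simp
  qed
  have "Comp C e e = Comp C (Id C (fst m)) e"
    by (rule e_equalizes[OF e elements_hom_id[OF mE]])
  also have "\<dots> = e" by (rule id_left[OF elements_hom_hom[OF e]])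
  finally have idem: "Comp C e e = e" .
  obtain a x where m_eq: "m = (a, x)" by (cases m)
  have ax: "a \<in> Ob C" "x \<in> FOb X a" "e \<in> hom C a a" "FAr X e x = x"
    using mE e m_eq by (auto simp: elements_hom_def)
  obtain b s i where split: "b \<in> Ob C" "s \<in> hom C a b" "i \<in> hom C b a"
      "Comp C s i = Id C b" "Comp C i s = e"
    using assms(2) ax idem unfolding cauchy_complete_def by meson
  define p where "p = (b, FAr X s x)"
  have s: "s \<in> elements_hom C X m p"
    using split ax by (auto simp: elements_hom_def p_def m_eq)
  have i: "i \<in> elements_hom C X p m"
    using split ax FAr_in[OF split(2)] FAr_comp[OF split(2,3) ax(2)]
    by (auto simp: elements_hom_def p_def m_eq)
  have "p \<in> Q" by (rule colim_closed[OF Q m(1) colim_eq_elements_hom[OF s]])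
  moreover have "\<exists>!f. f \<in> elements_hom C X p r" if r: "r \<in> Q" for r
  proof (rule ex_ex1I)
    show "\<exists>f. f \<in> elements_hom C X p r"
      using m(2)[OF r] elements_hom_comp[OF i] by blast
  next
    fix v v' assume v: "v \<in> elements_hom C X p r" and v': "v' \<in> elements_hom C X p r"
    \<comment> \<open>\<open>s e i = s i s i = 1\<close>, so precomposing with \<open>s e i\<close> recovers an arrow out of \<open>p\<close>.\<close>
    have recover: "w = Comp C (Comp C (Comp C w s) e) i" if "w \<in> elements_hom C X p r" for w
    proof -
      have w: "w \<in> hom C b (fst r)" using elements_hom_hom[OF that] by (simp add: p_def)
      have "Comp C (Comp C (Comp C w s) e) i = Comp C (Comp C w s) (Comp C e i)"
        using comp_assoc[OF split(3) ax(3) comp_in[OF split(2) w]] by simp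
      also have "Comp C e i = i"
        using comp_assoc[OF split(3,2,3)] split(4,5) id_right[OF split(3)] by simp
      also have "Comp C (Comp C w s) i = w"
        using comp_assoc[OF split(3,2) w] split(4) id_right[OF w] by simp
      finally show ?thesis by simp
    qed
    have "Comp C (Comp C v s) e = Comp C (Comp C v' s) e"
      using e_equalizes elements_hom_comp[OF s] v v' by blast
    then show "v = v'" using recover[OF v] recover[OF v'] by simp
  qed
  ultimately show ?thesis unfolding initial_element_def by blast
qed

section \<open>Counting\<close>

text \<open>The decomposition of \<open>X\<close> into representables, at the level of cardinalities. By the
  initiality of \<open>p Q\<close>, an element of \<open>X b\<close> in the component \<open>Q\<close> is the same as an arrow
  from \<open>p Q\<close> to it.\<close>

lemma card_FOb_eq_sum_hom:
  assumes "set_functor C X" and "finite (colim C X)" and "finite (Ar C)" and b: "b \<in> Ob C"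
    and p: "\<And>Q. Q \<in> colim C X \<Longrightarrow> initial_element C X Q (p Q)"
  shows "card (FOb X b) = (\<Sum>Q \<in> colim C X. card (hom C (fst (p Q)) b))"
proof -
  interpret set_functor C X by fact
  define \<Phi> where "\<Phi> = (\<lambda>(Q, f). FAr X f (snd (p Q)))"
  have pQ: "p Q \<in> Q" "p Q \<in> (SIGMA a : Ob C. FOb X a)" if "Q \<in> colim C X" for Q
    using p[OF that] colim_subset[OF that] by (auto simp: initial_element_def)
  have arrow: "f \<in> elements_hom C X (p Q) (b, \<Phi> (Q, f))"
    if "Q \<in> colim C X" "f \<in> hom C (fst (p Q)) b" for Q f
    using that pQ(2)[OF that(1)] by (auto simp: elements_hom_def \<Phi>_def)
  have target: "(b, \<Phi> (Q, f)) \<in> Q" if "Q \<in> colim C X" "f \<in> hom C (fst (p Q)) b" for Q f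
    using colim_closed[OF that(1) pQ(1)[OF that(1)] colim_eq_elements_hom[OF arrow[OF that]]] .
  have "bij_betw \<Phi> (SIGMA Q : colim C X. hom C (fst (p Q)) b) (FOb X b)"
    unfolding bij_betw_def
  proof
    show "inj_on \<Phi> (SIGMA Q : colim C X. hom C (fst (p Q)) b)"
    proof (rule inj_onI, clarify)
      fix Q f Q' f'
      assume Q: "Q \<in> colim C X" "f \<in> hom C (fst (p Q)) b"
        and Q': "Q' \<in> colim C X" "f' \<in> hom C (fst (p Q')) b" and eq: "\<Phi> (Q, f) = \<Phi> (Q', f')"
      have "Q = Q'"
        using colim_disjoint[OF Q(1) Q'(1) target[OF Q]] target[OF Q'] eq by simp
      moreover have "f = f'"
        using arrow[OF Q] arrow[OF Q'] p[OF Q(1)] target[OF Q] eq \<open>Q = Q'\<close>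
        unfolding initial_element_def by metis
      ultimately show "Q = Q' \<and> f = f'" ..
    qed
    show "\<Phi> ` (SIGMA Q : colim C X. hom C (fst (p Q)) b) = FOb X b"
    proof
      show "\<Phi> ` (SIGMA Q : colim C X. hom C (fst (p Q)) b) \<subseteq> FOb X b"
        using elements_hom_in(2)[OF arrow] by auto
      show "FOb X b \<subseteq> \<Phi> ` (SIGMA Q : colim C X. hom C (fst (p Q)) b)"
      proof
        fix y assume "y \<in> FOb X b"
        then obtain Q where Q: "Q \<in> colim C X" "(b, y) \<in> Q" using colim_ex[of "(b, y)"] b by blast
        then obtain f where "f \<in> elements_hom C X (p Q) (b, y)"
          using p[OF Q(1)] unfolding initial_element_def by blast
        then have "y = \<Phi> (Q, f)" "f \<in> hom C (fst (p Q)) b"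
          by (auto simp: elements_hom_def \<Phi>_def)
        then show "y \<in> \<Phi> ` (SIGMA Q : colim C X. hom C (fst (p Q)) b)" using Q(1) by blast
      qed
    qed
  qed
  then have "card (FOb X b) = card (SIGMA Q : colim C X. hom C (fst (p Q)) b)"
    by (simp add: bij_betw_same_card)
  also have "\<dots> = (\<Sum>Q \<in> colim C X. card (hom C (fst (p Q)) b))"
    using assms(2,3) by (intro card_SigmaI) (auto simp: hom_def)
  finally show ?thesis .
qed

theorem theorem3p3:
  fixes A :: "('o, 'm) cat" and X :: "('o, 'm, 'x) set_fun" and k :: "'o \<Rightarrow> rat"
  assumes "finite_category A"
    and "cauchy_complete A"
    and "weighting A k"
    and "set_functor A X"
    and "finite_set_functor A X"
    and "nondegenerate A X"
  shows "of_nat (card (colim A X)) = (\<Sum>a \<in> Ob A. k a * of_nat (card (FOb X a)))"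
proof -
  interpret finite_category A by fact
  interpret set_functor A X by fact
  obtain p where p: "\<And>Q. Q \<in> colim A X \<Longrightarrow> initial_element A X Q (p Q)"
    using initial_element_exists[OF assms(1,2,4,5,6)] by metis
  have Ob_p: "fst (p Q) \<in> Ob A" if "Q \<in> colim A X" for Q
    using p[OF that] colim_subset[OF that] by (auto simp: initial_element_def)
  have "(\<Sum>a \<in> Ob A. k a * of_nat (card (FOb X a)))
      = (\<Sum>a \<in> Ob A. \<Sum>Q \<in> colim A X. of_nat (card (hom A (fst (p Q)) a)) * k a)"
    using card_FOb_eq_sum_hom[OF assms(4) finite_colim[OF assms(5)] finite_Ar _ p]
    by (intro sum.cong) (simp_all add: sum_distrib_left mult.commute)
  also have "\<dots> = (\<Sum>Q \<in> colim A X. \<Sum>a \<in> Ob A. of_nat (card (hom A (fst (p Q)) a)) * k a)"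
    by (rule sum.swap)
  also have "\<dots> = (\<Sum>Q \<in> colim A X. 1)"
    using assms(3) Ob_p by (intro sum.cong) (auto simp: weighting_def)
  finally show ?thesis by simp
qed

end
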